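(* Let $S_3$ be the symmetric group of degree $3$. Then (1) every $\sigma\in S_3$ satisfies $\sigma\in GSPP_\rho(S_3)$ or $\sigma\in GSPP_\lambda(S_3)$ (or both); (2) $|GSPP_\rho(S_3)|=4$, $|GSPP_\lambda(S_3)|=4$ and $|GSPP(S_3)|=2$.
   Context: $S_3$ is the group of permutations of $\{1,2,3\}$. For $\sigma\in S_3$ put $N_\lambda(\sigma)=1\,2\,3\,\sigma(3)\,\sigma(2)\,\sigma(1)$ and $N_\rho(\sigma)=1\,2\,3\,\sigma(1)\,\sigma(2)\,\sigma(3)$, six-digit numbers regarded as strings of digits. A string of digits is a generalized Smarandache palindrome (GSP) if it can be split into consecutive non-empty blocks so that it has the form $a_1a_2\cdots a_ka_k\cdots a_2a_1$ ($k\ge1$) or $a_1a_2\cdots a_{k-1}a_ka_{k-1}\cdots a_2a_1$ ($k\ge2$), where each block $a_i$ consists of one or more digits (the trivial splitting into a single block is excluded). $GSPP_\lambda(S_3)$ is the set of $\sigma\in S_3$ for which $N_\lambda(\sigma)$ is a GSP (left generalized Smarandache palindromic permutations), $GSPP_\rho(S_3)$ is the set of $\sigma\in S_3$ for which $N_\rho(\sigma)$ is a GSP (right generalized Smarandache palindromic permutations), and $GSPP(S_3)=GSPP_\lambda(S_3)\cap GSPP_\rho(S_3)$. *)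

theory Defs
  imports "HOL-Algebra.Sym_Groups"
begin

(* Strings are lists of digits.  The list bs = [a_1, ..., a_k] holds the blocks, so
   that rev (butlast bs) is a_(k-1) ... a_1. *)
definition generalized_Smarandache_palindrome :: "'a list \<Rightarrow> bool" where
  "generalized_Smarandache_palindrome w \<longleftrightarrow>
     (\<exists>bs. length bs \<ge> 1 \<and> (\<forall>b\<in>set bs. b \<noteq> []) \<and> w = concat (bs @ rev bs)) \<or>
     (\<exists>bs. length bs \<ge> 2 \<and> (\<forall>b\<in>set bs. b \<noteq> []) \<and> w = concat (bs @ rev (butlast bs)))"

definition N_lambda :: "(nat \<Rightarrow> nat) \<Rightarrow> nat list" where
  "N_lambda \<sigma> = [1, 2, 3, \<sigma> 3, \<sigma> 2, \<sigma> 1]"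

definition N_rho :: "(nat \<Rightarrow> nat) \<Rightarrow> nat list" where
  "N_rho \<sigma> = [1, 2, 3, \<sigma> 1, \<sigma> 2, \<sigma> 3]"

(* Elements of carrier (sym_group 3) are functions on all of nat that
   fix every number outside {1..3}. *)
definition GSPP_lambda :: "(nat \<Rightarrow> nat) set" where
  "GSPP_lambda = {\<sigma> \<in> carrier (sym_group 3). generalized_Smarandache_palindrome (N_lambda \<sigma>)}"

definition GSPP_rho :: "(nat \<Rightarrow> nat) set" where
  "GSPP_rho = {\<sigma> \<in> carrier (sym_group 3). generalized_Smarandache_palindrome (N_rho \<sigma>)}"

definition GSPP :: "(nat \<Rightarrow> nat) set" where
  "GSPP = GSPP_lambda \<inter> GSPP_rho"

end

theory Submission
  imports Defs
begin

text \<open>The inner blocks of a generalized Smarandache palindrome can be merged into one, so a string is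
  one if and only if some non-empty block is both a prefix and a suffix of it, without overlap.  For
  \<open>1 2 3 x y z\<close> this leaves only the blocks \<open>1\<close>, \<open>1 2\<close> and \<open>1 2 3\<close>, to be compared with the ends of
  the six strings.\<close>

lemma generalized_Smarandache_palindrome_iff_border:
  "generalized_Smarandache_palindrome w \<longleftrightarrow> (\<exists>a m. a \<noteq> [] \<and> w = a @ m @ a)"
proof
  assume "generalized_Smarandache_palindrome w"
  then consider
      (even) bs where "length bs \<ge> 1" "\<forall>b\<in>set bs. b \<noteq> []" "w = concat (bs @ rev bs)"
    | (odd) bs where "length bs \<ge> 2" "\<forall>b\<in>set bs. b \<noteq> []" "w = concat (bs @ rev (butlast bs))"
    unfolding generalized_Smarandache_palindrome_def by blast
  then show "\<exists>a m. a \<noteq> [] \<and> w = a @ m @ a"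
  proof cases
    case even
    then obtain a cs where "bs = a # cs" by (cases bs) auto
    with even have "a \<noteq> [] \<and> w = a @ concat (cs @ rev cs) @ a" by simp
    then show ?thesis by blast
  next
    case odd
    then obtain a cs where bs: "bs = a # cs" by (cases bs) auto
    \<comment> \<open>With at least two blocks, \<open>butlast\<close> removes the central block and
      not the leading \<open>a\<close>, so \<open>a\<close> still closes the string.\<close>
    with odd(1) have "cs \<noteq> []" by auto
    with bs odd have "a \<noteq> [] \<and> w = a @ concat (cs @ rev (butlast cs)) @ a" by simp
    then show ?thesis by blast
  qed
next
  assume "\<exists>a m. a \<noteq> [] \<and> w = a @ m @ a"
  then obtain a m where am: "a \<noteq> []" "w = a @ m @ a" by blast
  show "generalized_Smarandache_palindrome w"
  \<comment> \<open>Blocks are non-empty, so an empty middle calls for the even form; otherwise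
    \<open>m\<close> serves as the central block of the odd form.\<close>
  proof (cases "m = []")
    case True
    with am have "length [a] \<ge> 1 \<and> (\<forall>b\<in>set [a]. b \<noteq> []) \<and> w = concat ([a] @ rev [a])" by simp
    then show ?thesis unfolding generalized_Smarandache_palindrome_def by blast
  next
    case False
    with am have "length [a, m] \<ge> 2 \<and> (\<forall>b\<in>set [a, m]. b \<noteq> []) \<and>
        w = concat ([a, m] @ rev (butlast [a, m]))" by simp
    then show ?thesis unfolding generalized_Smarandache_palindrome_def by blast
  qed
qed

text \<open>A repeated outer block of length n needs 2n \<le> 6; the three disjuncts belong to n =
  1, 2, 3 in this order.\<close>

lemma generalized_Smarandache_palindrome_123:
  fixes x y z :: nat
  shows "generalized_Smarandache_palindrome [1, 2, 3, x, y, z] \<longleftrightarrow>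
    z = 1 \<or> y = 1 \<and> z = 2 \<or> x = 1 \<and> y = 2 \<and> z = 3" (is "_ \<longleftrightarrow> ?R")
proof
  assume "generalized_Smarandache_palindrome [1, 2, 3, x, y, z]"
  then obtain a m where a: "a \<noteq> []" and w: "[1, 2, 3, x, y, z] = a @ m @ a"
    unfolding generalized_Smarandache_palindrome_iff_border by blast
  define n where "n = length a"
  have "length [1, 2, 3, x, y, z] = length (a @ m @ a)" using w by (rule arg_cong)
  then have len: "length m + 2 * n = 6" by (simp add: n_def)
  have "take n [1, 2, 3, x, y, z] = a" unfolding w by (simp add: n_def)
  \<comment> \<open>Reading \<open>len\<close> from right to left turns 6 - n into the length of
    \<open>a @ m\<close>, the part before the final copy of \<open>a\<close>.\<close>
  moreover have "drop (6 - n) [1, 2, 3, x, y, z] = a"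
    unfolding w by (simp add: n_def flip: len)
  ultimately have eq: "take n [1, 2, 3, x, y, z] = drop (6 - n) [1, 2, 3, x, y, z]" by simp
  have "n \<noteq> 0" using a by (simp add: n_def)
  with len have "n = 1 \<or> n = 2 \<or> n = 3" by linarith
  then show ?R using eq by (elim disjE) auto
next
  have "\<exists>a m. a \<noteq> [] \<and> [1, 2, 3, x, y, 1] = a @ m @ a"
    by (rule exI[of _ "[1]"], rule exI[of _ "[2, 3, x, y]"]) simp
  moreover have "\<exists>a m. a \<noteq> [] \<and> [1, 2, 3, x, 1, 2] = a @ m @ a"
    by (rule exI[of _ "[1, 2]"], rule exI[of _ "[3, x]"]) simp
  moreover have "\<exists>a m. a \<noteq> [] \<and> [1, 2, 3, 1, 2, 3::nat] = a @ m @ a"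
    by (rule exI[of _ "[1, 2, 3]"], rule exI[of _ "[]"]) simp
  ultimately show "generalized_Smarandache_palindrome [1, 2, 3, x, y, z]" if ?R
    using that unfolding generalized_Smarandache_palindrome_iff_border by blast
qed

text \<open>Updating \<open>id\<close> keeps every number outside \<open>{1..3}\<close> fixed, as
  membership in the carrier demands.\<close>

definition one_line :: "nat \<Rightarrow> nat \<Rightarrow> nat \<Rightarrow> nat \<Rightarrow> nat" where
  "one_line a b c = id(1 := a, 2 := b, 3 := c)"

text \<open>The argument 1 appears as \<open>Suc 0\<close> because the simplifier normalizes it to
  that form.\<close>

lemma one_line_apply [simp]:
  "one_line a b c (Suc 0) = a" "one_line a b c 2 = b" "one_line a b c 3 = c"
  by (simp_all add: one_line_def)

text \<open>This lets the simplifier tell listed permutations apart, which the cardinalities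
  require.\<close>

lemma one_line_eq_iff [simp]:
  "one_line a b c = one_line a' b' c' \<longleftrightarrow> a = a' \<and> b = b' \<and> c = c'"
  by (auto dest: fun_cong[where x = 1] fun_cong[where x = 2] fun_cong[where x = 3])

lemma atLeastAtMost_1_3: "{1..3::nat} = {1, 2, 3}"
  by auto

lemma one_line_permutes:
  assumes "{a, b, c} = {1, 2, 3}"
  shows "one_line a b c permutes {1..3}"
proof (rule bij_imp_permutes)
  have "one_line a b c ` {1..3} = {1..3}"
    using assms unfolding atLeastAtMost_1_3 by simp
  then show "bij_betw (one_line a b c) {1..3} {1..3}"
    \<comment> \<open>On a finite set surjectivity gives injectivity, so distinctness of
      \<open>a\<close>, \<open>b\<close>, \<open>c\<close> need not be assumed separately.\<close>
    by (simp add: bij_betw_def finite_surj_inj)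
  show "one_line a b c x = x" if "x \<notin> {1..3}" for x
    using that by (auto simp: one_line_def)
qed

lemma permutes_1_3_eq_one_line:
  assumes "\<sigma> permutes {1..3}"
  shows "\<sigma> = one_line (\<sigma> 1) (\<sigma> 2) (\<sigma> 3)"
  using permutes_not_in[OF assms]
  by (auto simp: fun_eq_iff one_line_def atLeastAtMost_1_3)

lemma carrier_sym_group_3:
  "carrier (sym_group 3) =
    {one_line 1 2 3, one_line 1 3 2, one_line 2 1 3, one_line 2 3 1, one_line 3 1 2, one_line 3 2 1}"
    (is "_ = ?S")
proof -
  have "\<sigma> \<in> ?S" if perm: "\<sigma> permutes {1..3}" for \<sigma>
  proof -
    have "\<sigma> 1 \<in> {1, 2, 3}" "\<sigma> 2 \<in> {1, 2, 3}" "\<sigma> 3 \<in> {1, 2, 3}"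
      using permutes_in_image[OF perm] unfolding atLeastAtMost_1_3 by blast+
    moreover have "\<sigma> 1 \<noteq> \<sigma> 2" "\<sigma> 1 \<noteq> \<sigma> 3" "\<sigma> 2 \<noteq> \<sigma> 3"
      using permutes_inj[OF perm] by (simp_all add: inj_eq)
    ultimately have "one_line (\<sigma> 1) (\<sigma> 2) (\<sigma> 3) \<in> ?S"
      unfolding insert_iff empty_iff one_line_eq_iff by metis
    then show ?thesis unfolding permutes_1_3_eq_one_line[OF perm, symmetric] .
  qed
  moreover have "?S \<subseteq> {\<sigma>. \<sigma> permutes {1..3}}"
    unfolding insert_subset mem_Collect_eq
    by (intro conjI one_line_permutes empty_subsetI; blast)
  ultimately show ?thesis unfolding sym_group_def by auto
qed

text \<open>Filters an explicitly listed set one element at a time.\<close>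

lemma Collect_mem_insert_conj:
  "{x \<in> insert a A. P x} = (if P a then insert a {x \<in> A. P x} else {x \<in> A. P x})"
  by auto

theorem lemma3p1:
  "(\<forall>\<sigma> \<in> carrier (sym_group 3). \<sigma> \<in> GSPP_rho \<or> \<sigma> \<in> GSPP_lambda) \<and>
   card GSPP_rho = 4 \<and> card GSPP_lambda = 4 \<and> card GSPP = 2"
  \<comment> \<open>In one-line notation the right set is 123, 231, 312, 321 and the left set is
    123, 132, 213, 321. They cover the whole group and share 123 and 321.\<close>
  unfolding GSPP_def GSPP_rho_def GSPP_lambda_def N_rho_def N_lambda_def
    generalized_Smarandache_palindrome_123 carrier_sym_group_3 Collect_mem_insert_conj
  by simp

end
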